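(* Let $t\geq 4$ be an even integer and $n\geq 1$ an integer. Then there exists a balanced $\left(\frac{t}{2}\right)^n$-coloring of $C_t^n$ that contains no rainbow geometric line.
   Context: For positive integers $t,n$, $C_t^n=\{x_1x_2\cdots x_n : x_i\in\{0,1,\dots,t-1\}\}$ is the set of ordered $n$-tuples over the alphabet $\{0,\dots,t-1\}$. A geometric line in $C_t^n$ is a sequence of $t$ distinct points $\mathbf{x}_0,\mathbf{x}_1,\dots,\mathbf{x}_{t-1}$, $\mathbf{x}_i=x_{i1}x_{i2}\cdots x_{in}$, such that for each coordinate $j\in\{1,\dots,n\}$ one of the following holds: (1) $x_{0j}=x_{1j}=\cdots=x_{t-1,j}$; (2) $x_{ij}=i$ for every $0\le i\le t-1$; (3) $x_{ij}=t-1-i$ for every $0\le i\le t-1$. A $k$-coloring of $C_t^n$ is a surjective map $f:C_t^n\to\{0,\dots,k-1\}$; it is balanced if all color classes $f^{-1}(s)$ have the same cardinality. A geometric line is rainbow if its $t$ points receive pairwise distinct colors. *)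

theory Defs
  imports Main
begin

text \<open>Points are lists, so the coordinates \<open>1, \<dots>, n\<close> become the list positions \<open>0, \<dots>, n - 1\<close>.\<close>

definition cube :: "nat \<Rightarrow> nat \<Rightarrow> nat list set" where
  "cube t n = {x. length x = n \<and> set x \<subseteq> {..<t}}"

definition geometric_line :: "nat \<Rightarrow> nat \<Rightarrow> nat list list \<Rightarrow> bool" where
  "geometric_line t n L \<longleftrightarrow>
     length L = t \<and> set L \<subseteq> cube t n \<and> distinct L \<and>
     (\<forall>j<n. (\<forall>i<t. \<forall>i'<t. L ! i ! j = L ! i' ! j) \<or>
            (\<forall>i<t. L ! i ! j = i) \<or>
            (\<forall>i<t. L ! i ! j = t - 1 - i))"

definition coloring :: "nat \<Rightarrow> nat \<Rightarrow> nat \<Rightarrow> (nat list \<Rightarrow> nat) \<Rightarrow> bool" where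
  "coloring t n k f \<longleftrightarrow> f ` cube t n = {..<k}"

definition color_class :: "nat \<Rightarrow> nat \<Rightarrow> (nat list \<Rightarrow> nat) \<Rightarrow> nat \<Rightarrow> nat list set" where
  "color_class t n f s = {x \<in> cube t n. f x = s}"

definition balanced_coloring :: "nat \<Rightarrow> nat \<Rightarrow> nat \<Rightarrow> (nat list \<Rightarrow> nat) \<Rightarrow> bool" where
  "balanced_coloring t n k f \<longleftrightarrow>
     coloring t n k f \<and>
     (\<forall>s<k. \<forall>s'<k. card (color_class t n f s) = card (color_class t n f s'))"

definition rainbow :: "(nat list \<Rightarrow> nat) \<Rightarrow> nat list list \<Rightarrow> bool" where
  "rainbow f L \<longleftrightarrow> distinct (map f L)"

end

theory Submission
  imports Defs
begin

text \<open>Identify each letter \<open>a\<close> with its mirror image \<open>t - 1 - a\<close>, coordinate by coordinate: this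
  partitions the cube into \<open>(t/2)\<^sup>n\<close> classes of size \<open>2\<^sup>n\<close>. Reversing a geometric line mirrors its
  active coordinates and fixes the others, so the two ends of every line get the same colour.\<close>

definition fold_letter :: "nat \<Rightarrow> nat \<Rightarrow> nat" where
  "fold_letter t a = min a (t - 1 - a)"

lemma fold_letter_less: "even t \<Longrightarrow> a < t \<Longrightarrow> fold_letter t a < t div 2"
  by (auto simp: fold_letter_def min_def elim!: evenE)

lemma fold_letter_id: "a < t div 2 \<Longrightarrow> fold_letter t a = a"
  by (auto simp: fold_letter_def min_def)

text \<open>Evenness of \<open>t\<close> enters here: a letter equal to its own mirror image would
  satisfy \<open>2 * a = t - 1\<close>, which is odd. So no mirror pair collapses, which is what
  makes all colour classes equally large.\<close>

lemma card_fold_letter_fibre: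
  assumes "even t" "a < t div 2"
  shows "card {b. b < t \<and> fold_letter t b = a} = 2"
proof -
  have "{b. b < t \<and> fold_letter t b = a} = {a, t - 1 - a}"
    using assms by (auto simp: fold_letter_def min_def elim!: evenE)
  moreover have "a \<noteq> t - 1 - a"
    using assms by (auto elim!: evenE)
  ultimately show ?thesis
    by simp
qed

lemma finite_cube: "finite (cube t n)"
  using finite_lists_length_eq[of "{..<t}" n] by (simp add: cube_def conj_commute)

lemma card_cube: "card (cube t n) = t ^ n"
  using card_lists_length_eq[of "{..<t}" n] by (simp add: cube_def conj_commute)

text \<open>Taking the minimum selects the lower letter of each mirror pair, so the folded words
  form a cube over half the alphabet; each of its words is fixed by folding and hence its own
  preimage.\<close>

lemma map_fold_letter_image_cube:
  assumes "even t"
  shows "map (fold_letter t) ` cube t n = cube (t div 2) n"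
proof
  show "map (fold_letter t) ` cube t n \<subseteq> cube (t div 2) n"
    using fold_letter_less[OF assms] by (auto simp: cube_def subset_iff)
  show "cube (t div 2) n \<subseteq> map (fold_letter t) ` cube t n"
  proof
    fix y assume y: "y \<in> cube (t div 2) n"
    then have "map (fold_letter t) y = y"
      by (auto simp: cube_def fold_letter_id intro!: map_idI)
    moreover have "y \<in> cube t n"
      using y by (auto simp: cube_def)
    ultimately show "y \<in> map (fold_letter t) ` cube t n"
      by (metis imageI)
  qed
qed

text \<open>Folding acts letter by letter, so a fibre is a product of \<open>n\<close> mirror pairs;
  each letter of \<open>y\<close> contributes a factor 2.\<close>

lemma card_map_fold_letter_fibre:
  assumes "even t" "y \<in> cube (t div 2) n"
  shows "card {x \<in> cube t n. map (fold_letter t) x = y} = 2 ^ n"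
  using assms(2)
proof (induction y arbitrary: n)
  case Nil
  then have "{x \<in> cube t n. map (fold_letter t) x = []} = {[]}"
    by (auto simp: cube_def)
  with Nil show ?case
    by (simp add: cube_def)
next
  case (Cons a y)
  then obtain k where n: "n = Suc k" and a: "a < t div 2" and y: "y \<in> cube (t div 2) k"
    by (auto simp: cube_def)
  let ?B = "{b. b < t \<and> fold_letter t b = a}"
  let ?X = "{x \<in> cube t k. map (fold_letter t) x = y}"
  have "{x \<in> cube t n. map (fold_letter t) x = a # y} = (\<lambda>(b, x). b # x) ` (?B \<times> ?X)"
    by (auto simp: cube_def n map_eq_Cons_conv)
  moreover have "inj_on (\<lambda>(b, x). b # x) (?B \<times> ?X)"
    by (auto simp: inj_on_def)
  ultimately show ?case
    using Cons.IH[OF y] card_fold_letter_fibre[OF assms(1) a]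
    by (simp add: card_image card_cartesian_product n)
qed

lemma geometric_line_ends:
  assumes L: "geometric_line t n L" and t: "0 < t"
  shows "map (fold_letter t) (L ! 0) = map (fold_letter t) (L ! (t - 1))"
proof (rule nth_equalityI)
  have mem: "L ! 0 \<in> cube t n" "L ! (t - 1) \<in> cube t n"
    using L t by (auto simp: geometric_line_def)
  then show "length (map (fold_letter t) (L ! 0)) = length (map (fold_letter t) (L ! (t - 1)))"
    by (simp add: cube_def)
  fix j assume "j < length (map (fold_letter t) (L ! 0))"
  then have j: "j < n"
    using mem by (simp add: cube_def)
  \<comment> \<open>The three kinds of coordinate, read off only at the indices \<open>0\<close> and
    \<open>t - 1\<close>: constant, increasing, decreasing. In the last two the letters are
    \<open>0\<close> and \<open>t - 1\<close>, which both fold to \<open>0\<close>.\<close>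
  then consider "L ! 0 ! j = L ! (t - 1) ! j"
    | "L ! 0 ! j = 0" "L ! (t - 1) ! j = t - 1"
    | "L ! 0 ! j = t - 1" "L ! (t - 1) ! j = 0"
    using L t unfolding geometric_line_def
    by (metis diff_less diff_self_eq_0 diff_zero zero_less_one)
  then have "fold_letter t (L ! 0 ! j) = fold_letter t (L ! (t - 1) ! j)"
    by cases (simp_all add: fold_letter_def)
  then show "map (fold_letter t) (L ! 0) ! j = map (fold_letter t) (L ! (t - 1)) ! j"
    using mem j by (simp add: cube_def)
qed

theorem theorem3:
  fixes t n :: nat
  assumes "t \<ge> 4" and "even t" and "n \<ge> 1"
  shows "\<exists>f. balanced_coloring t n ((t div 2) ^ n) f \<and>
             \<not> (\<exists>L. geometric_line t n L \<and> rainbow f L)"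
proof -
  let ?m = "t div 2"
  \<comment> \<open>Any numbering of the folded words will do: it only turns them into
    colours.\<close>
  obtain h where h: "bij_betw h (cube ?m n) {..<?m ^ n}"
    using ex_bij_betw_finite_nat[OF finite_cube[of ?m n]]
    by (auto simp: card_cube atLeast0LessThan)
  define f where "f = h \<circ> map (fold_letter t)"
  have img: "f ` cube t n = {..<?m ^ n}"
    using h map_fold_letter_image_cube[OF assms(2), of n]
    by (simp only: f_def image_comp[symmetric] bij_betw_def)
  have card_class: "card (color_class t n f s) = 2 ^ n" if s: "s < ?m ^ n" for s
  proof -
    obtain y where y: "y \<in> cube ?m n" "h y = s"
      using h s unfolding bij_betw_def by (metis imageE lessThan_iff)
    \<comment> \<open>Since \<open>h\<close> is injective on folded words, a colour class is exactly
      one fibre of folding.\<close>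
    have "f x = s \<longleftrightarrow> map (fold_letter t) x = y" if "x \<in> cube t n" for x
    proof -
      have "map (fold_letter t) x \<in> cube ?m n"
        using that map_fold_letter_image_cube[OF assms(2)] by blast
      then show ?thesis
        using h y by (auto simp: f_def bij_betw_def inj_on_def)
    qed
    then have "color_class t n f s = {x \<in> cube t n. map (fold_letter t) x = y}"
      by (auto simp: color_class_def)
    then show ?thesis
      using card_map_fold_letter_fibre[OF assms(2) y(1)] by simp
  qed
  have "\<not> rainbow f L" if L: "geometric_line t n L" for L
  proof -
    have "length L = t"
      using L by (simp add: geometric_line_def)
    moreover have "f (L ! 0) = f (L ! (t - 1))"
      using geometric_line_ends[OF L] assms(1) by (simp add: f_def)
    ultimately show ?thesis
      \<comment> \<open>As \<open>t \<ge> 4\<close>, the positions \<open>0\<close> and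
        \<open>t - 1\<close> differ, so the common end colour is a genuine repetition.\<close>
      using assms(1) nth_eq_iff_index_eq[of "map f L" 0 "t - 1"]
      by (auto simp: rainbow_def)
  qed
  then show ?thesis
    using img card_class unfolding balanced_coloring_def coloring_def by metis
qed

end
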